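(* Let $B=\{p_1,\dots,p_m\}$ be a finite set of nonzero polynomials in $R[x_1,\dots,x_n]$ such that all the G-polynomials and all the M-polynomials of $B$ reduce to $0$ using $B$. Then every polynomial in the ideal $(B)$ reduces to $0$ using $B$; that is, $B$ is a weak Gröbner basis of $(B)$.
   Context: Ring and reduction. $R$ is a commutative ring with $1$. There is a reduction relation on $R$: for $a,c\in R$ and a finite nonempty set $\{b_1,\dots,b_k\}\subseteq R$ one may have "$a\to c$ using $\{b_1,\dots,b_k\}$" (if $k=1$: "$a\to c$ by $b_1$"). We say $a$ reduces using (or by) a set if $a\to c$ using it for some $c$. For $B\subseteq R$, a reduction step using $B$ is a step using some finite nonempty subset of $B$; $a$ is in normal form using $B$ if no reduction step using $B$ applies to it; a normal form of $a$ using $B$ is an element in normal form reachable from $a$ by finitely many (possibly zero) steps using $B$. The relation $\to$ (steps using arbitrary elements of $R$) is well-founded, i.e. there is no infinite sequence of steps, and satisfies: (i) a nonzero $a$ reduces to $0$ by $b$ if $a$ is a multiple of $b$; (ii) if $a\to c$ using $\{b_1,\dots,b_k\}$ then $a-c\in(b_1,\dots,b_k)$; (iii) if $a$ reduces using $\{b_1,\dots,b_k\}$ and each $b_i$ reduces by $\{c_1,\dots,c_j\}$, then $a$ also reduces by $\{c_1,\dots,c_j\}$. A basis (generating set) $B$ of an ideal of $R$ is a weak Gröbner basis if every element of the ideal has $0$ as a normal form using $B$. Every ideal of $R$ is assumed to have a finite weak Gröbner basis; Gröbner is a function sending each finite generating set of an ideal of $R$ to a finite weak Gröbner basis of that ideal.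 It is also assumed that the module of solutions of a homogeneous linear equation over $R$ has a finite generating set. Polynomials. Terms are power products of $x_1,\dots,x_n$, with a fixed admissible total well-ordering (compatible with multiplication, $1$ least). For nonzero $p$, $HD(p)$, $HT(p)$, $HC(p)$ are its head-monomial, head-term, head-coefficient, so $HD(p)=HC(p)\cdot HT(p)$. $p\to q$ using nonzero polynomials $\{p_1,\dots,p_k\}$ iff there is a monomial $ct$ of $p$ ($p=ct+p'$, $c\neq 0$ the coefficient of $t$ in $p$) such that each $HT(p_i)$ divides $t$, say $t=t_i'\cdot HT(p_i)$, and there are $d,k_1,\dots,k_k\in R$ with $c\to d$ using $\{HC(p_1),\dots,HC(p_k)\}$, $c=\sum_i k_i\, HC(p_i)+d$ and $q=p-\sum_i k_i t_i' p_i$. A step using a set of polynomials is a step using some finite nonempty subset; "$p$ reduces to $0$ using $B$" means that some finite (possibly empty) sequence of steps using $B$ leads from $p$ to $0$. Critical pairs. Let $F=\{p_1,\dots,p_j\}$ be a nonempty finite set of nonzero polynomials, $c_i=HC(p_i)$, $t_i=HT(p_i)$, $t=\mathrm{lcm}(t_1,\dots,t_j)=s_1t_1=\dots=s_jt_j$ with terms $s_i$. Let $\{g_1,\dots,g_l\}=\text{Gröbner}(\{c_1,\dots,c_j\})$ and fix representations $g_i=h_{i,1}c_1+\dots+h_{i,j}c_j$ with $h_{i,r}\in R$; the G-polynomials of $F$ are $q_i=h_{i,1}s_1p_1+\dots+h_{i,j}s_jp_j$, $1\le i\le l$. Let $A_1,\dots,A_v$, with $A_i=\langle b_{i,1},\dots,b_{i,j}\rangle$,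 be a fixed finite generating set of the module $\{\langle a_1,\dots,a_j\rangle\in R^j : a_1c_1+\dots+a_jc_j=0\}$; the M-polynomials of $F$ are $q_i=b_{i,1}s_1p_1+\dots+b_{i,j}s_jp_j$, $1\le i\le v$. A G-polynomial (M-polynomial) of $B$ is a G-polynomial (M-polynomial) of some nonempty finite subset $F$ of $B$.
   Formalization: Added assumption: for each finite C, Gröbner(C) with 0 removed is still a weak Gröbner basis of (C) (automatic if steps use only nonzero elements); without it the claim is false. In (iii), "reduces using a set" means a step using some nonempty subset of it. *)

theory Defs
  imports Complex_Main "HOL-Library.Poly_Mapping"
begin

section \<open>Ideals, reduction relations, weak Groebner bases\<close>

abbreviation ideal_gen :: "'r::comm_ring_1 set \<Rightarrow> 'r set" where
  "ideal_gen \<equiv> module.span (*)"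

abbreviation is_ideal :: "'r::comm_ring_1 set \<Rightarrow> bool" where
  "is_ideal \<equiv> module.subspace (*)"

lemma module_times: "module ((*) :: 'r::comm_ring_1 \<Rightarrow> 'r \<Rightarrow> 'r)"
  by unfold_locales (simp_all add: algebra_simps)

text \<open>
  A reduction relation is a ternary predicate: \<open>red S a c\<close> means ``\<open>a \<rightarrow> c\<close> using
  exactly the set \<open>S\<close>''. Only its values on finite nonempty \<open>S\<close> are ever used. The notions
  below are shared by the coefficient ring and the polynomial ring.
\<close>

definition step_using :: "('r set \<Rightarrow> 'r \<Rightarrow> 'r \<Rightarrow> bool) \<Rightarrow> 'r set \<Rightarrow> 'r \<Rightarrow> 'r \<Rightarrow> bool" where
  "step_using red B a c \<longleftrightarrow> (\<exists>S. finite S \<and> S \<noteq> {} \<and> S \<subseteq> B \<and> red S a c)"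

definition reducible_using :: "('r set \<Rightarrow> 'r \<Rightarrow> 'r \<Rightarrow> bool) \<Rightarrow> 'r set \<Rightarrow> 'r \<Rightarrow> bool" where
  "reducible_using red B a \<longleftrightarrow> (\<exists>c. step_using red B a c)"

abbreviation reduces_to :: "('r set \<Rightarrow> 'r \<Rightarrow> 'r \<Rightarrow> bool) \<Rightarrow> 'r set \<Rightarrow> 'r \<Rightarrow> 'r \<Rightarrow> bool" where
  "reduces_to red B \<equiv> (step_using red B)\<^sup>*\<^sup>*"

definition is_normal_form_of ::
    "('r set \<Rightarrow> 'r \<Rightarrow> 'r \<Rightarrow> bool) \<Rightarrow> 'r set \<Rightarrow> 'r \<Rightarrow> 'r \<Rightarrow> bool" where
  "is_normal_form_of red B c a \<longleftrightarrow> reduces_to red B a c \<and> \<not> reducible_using red B c"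

definition weak_groebner_basis ::
    "('r::comm_ring_1 set \<Rightarrow> 'r \<Rightarrow> 'r \<Rightarrow> bool) \<Rightarrow> 'r set \<Rightarrow> 'r set \<Rightarrow> bool" where
  "weak_groebner_basis red B I \<longleftrightarrow>
     ideal_gen B = I \<and> (\<forall>a\<in>I. is_normal_form_of red B 0 a)"


section \<open>Modules of solutions of homogeneous linear equations\<close>

text \<open>
  For a finite index set \<open>I\<close>, the free module \<open>R\<^sup>I\<close> consists of the finitely supported
  functions with support in \<open>I\<close>.
\<close>

definition tuple_scale :: "'r::comm_ring_1 \<Rightarrow> ('i \<Rightarrow>\<^sub>0 'r) \<Rightarrow> ('i \<Rightarrow>\<^sub>0 'r)" where
  "tuple_scale r a = Poly_Mapping.map ((*) r) a"

lemma lookup_tuple_scale: "Poly_Mapping.lookup (tuple_scale r a) i = r * Poly_Mapping.lookup a i"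
  by (cases "Poly_Mapping.lookup a i = 0") (simp_all add: tuple_scale_def Poly_Mapping.map.rep_eq)

lemma module_tuple_scale: "module (tuple_scale :: 'r::comm_ring_1 \<Rightarrow> ('i \<Rightarrow>\<^sub>0 'r) \<Rightarrow> _)"
  by unfold_locales
    (auto intro!: poly_mapping_eqI simp: lookup_tuple_scale lookup_add algebra_simps)

definition solutions :: "'i set \<Rightarrow> ('i \<Rightarrow> 'r::comm_ring_1) \<Rightarrow> ('i \<Rightarrow>\<^sub>0 'r) set" where
  "solutions I c = {a. Poly_Mapping.keys a \<subseteq> I \<and> (\<Sum>i\<in>I. Poly_Mapping.lookup a i * c i) = 0}"


section \<open>The coefficient ring\<close>

text \<open>
  In \<open>red_trans\<close>, ``reduces using a set'' means that some step using that set, i.e. using some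
  finite nonempty subset of it, applies.

  \<open>groebner_minus_zero\<close> is a nondegeneracy condition on zero elements of the computed bases.
  It is immediate if these bases consist of nonzero elements, and it also follows if
  reduction steps only use nonzero elements. Some such condition is needed: an axiom-satisfying
  relation may have steps that use \<open>{0, b}\<close>, to which \<open>red_trans\<close> never applies, as \<open>0\<close> is
  irreducible.
\<close>

locale reduction_ring =
  fixes red :: "'a::comm_ring_1 set \<Rightarrow> 'a \<Rightarrow> 'a \<Rightarrow> bool"
    and groebner :: "'a set \<Rightarrow> 'a set"
  assumes red_wf: "wfp (\<lambda>c a. step_using red UNIV a c)"
    and red_multiple: "a \<noteq> 0 \<Longrightarrow> b dvd a \<Longrightarrow> red {b} a 0"
    and red_diff: "finite S \<Longrightarrow> S \<noteq> {} \<Longrightarrow> red S a c \<Longrightarrow> a - c \<in> ideal_gen S"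
    and red_trans: "finite S \<Longrightarrow> S \<noteq> {} \<Longrightarrow> finite C \<Longrightarrow> C \<noteq> {} \<Longrightarrow>
        reducible_using red S a \<Longrightarrow> (\<And>b. b \<in> S \<Longrightarrow> reducible_using red C b) \<Longrightarrow>
        reducible_using red C a"
    and ex_weak_groebner: "is_ideal I \<Longrightarrow> \<exists>G. finite G \<and> weak_groebner_basis red G I"
    and finite_groebner: "finite C \<Longrightarrow> finite (groebner C)"
    and groebner: "finite C \<Longrightarrow> weak_groebner_basis red (groebner C) (ideal_gen C)"
    and groebner_minus_zero:
      "finite C \<Longrightarrow> weak_groebner_basis red (groebner C - {0}) (ideal_gen C)"
    and solutions_finitely_generated:
      "\<exists>A. finite A \<and> module.span tuple_scale A = solutions {..<j} (w :: nat \<Rightarrow> 'a)"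


section \<open>Polynomials and their reduction\<close>

text \<open>
  A power product is its exponent vector, so that products of terms are sums, the term \<open>1\<close> is
  \<open>0\<close>, and quotients of terms are differences. The product of polynomials is the convolution
  product of \<^theory>\<open>HOL-Library.Poly_Mapping\<close>.
\<close>

type_synonym 'n pp = "'n \<Rightarrow>\<^sub>0 nat"
type_synonym ('n, 'a) mpoly = "('n \<Rightarrow>\<^sub>0 nat) \<Rightarrow>\<^sub>0 'a"

definition pp_dvd :: "'n pp \<Rightarrow> 'n pp \<Rightarrow> bool" where
  "pp_dvd s t \<longleftrightarrow> (\<exists>u. t = u + s)"

definition pp_lcm :: "('n::finite) pp set \<Rightarrow> 'n pp" where
  "pp_lcm T = Abs_poly_mapping (\<lambda>x. Max ((\<lambda>t. Poly_Mapping.lookup t x) ` T))"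

lemma pp_dvd_iff: "pp_dvd s t \<longleftrightarrow> (\<forall>x. Poly_Mapping.lookup s x \<le> Poly_Mapping.lookup t x)"
proof
  assume "\<forall>x. Poly_Mapping.lookup s x \<le> Poly_Mapping.lookup t x"
  then have "t = (t - s) + s"
    by (intro poly_mapping_eqI) (simp add: lookup_add lookup_minus)
  then show "pp_dvd s t" unfolding pp_dvd_def ..
qed (auto simp: pp_dvd_def lookup_add)

lemma pp_lcm_dvd_iff:
  assumes "finite T" "T \<noteq> {}"
  shows "pp_dvd (pp_lcm T) u \<longleftrightarrow> (\<forall>t\<in>T. pp_dvd t u)"
proof -
  have "Poly_Mapping.lookup (pp_lcm T) x = Max ((\<lambda>t. Poly_Mapping.lookup t x) ` T)" for x
    by (simp add: pp_lcm_def)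
  then show ?thesis
    using assms by (auto simp: pp_dvd_iff)
qed

locale admissible_order = wellorder tle tless
  for tle tless :: "('n::finite) pp \<Rightarrow> 'n pp \<Rightarrow> bool" +
  assumes tle_zero: "tle 0 t"
    and tle_add: "tle s t \<Longrightarrow> tle (s + u) (t + u)"

text \<open>\<open>HT\<close> and \<open>HC\<close> are only meaningful for nonzero polynomials.\<close>

definition HT :: "('n pp \<Rightarrow> 'n pp \<Rightarrow> bool) \<Rightarrow> ('n, 'a::zero) mpoly \<Rightarrow> 'n pp" where
  "HT tle p = linorder.Max tle (Poly_Mapping.keys p)"

definition HC :: "('n pp \<Rightarrow> 'n pp \<Rightarrow> bool) \<Rightarrow> ('n, 'a::zero) mpoly \<Rightarrow> 'a" where
  "HC tle p = Poly_Mapping.lookup p (HT tle p)"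

text \<open>
  The finite family \<open>p\<^sub>1, \<dots>, p\<^sub>k\<close> is the set \<open>P\<close>, indexed by itself; different members
  may have the same head coefficient.
\<close>

definition poly_red ::
    "('a::comm_ring_1 set \<Rightarrow> 'a \<Rightarrow> 'a \<Rightarrow> bool) \<Rightarrow> ('n pp \<Rightarrow> 'n pp \<Rightarrow> bool) \<Rightarrow>
     ('n, 'a) mpoly set \<Rightarrow> ('n, 'a) mpoly \<Rightarrow> ('n, 'a) mpoly \<Rightarrow> bool" where
  "poly_red red tle P p q \<longleftrightarrow>
     0 \<notin> P \<and>
     (\<exists>t\<in>Poly_Mapping.keys p. (\<forall>f\<in>P. pp_dvd (HT tle f) t) \<and>
        (\<exists>d k. red (HC tle ` P) (Poly_Mapping.lookup p t) d \<and>
               Poly_Mapping.lookup p t = (\<Sum>f\<in>P. k f * HC tle f) + d \<and>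
               q = p - (\<Sum>f\<in>P. Poly_Mapping.single (t - HT tle f) (k f) * f)))"


section \<open>G-polynomials and M-polynomials\<close>

text \<open>The cofactor \<open>s\<^sub>i\<close> in \<open>lcm(t\<^sub>1, \<dots>, t\<^sub>j) = s\<^sub>i t\<^sub>i\<close>, for \<open>f = p\<^sub>i\<close>.\<close>

definition cofactor ::
    "(('n::finite) pp \<Rightarrow> 'n pp \<Rightarrow> bool) \<Rightarrow> ('n, 'a::zero) mpoly set \<Rightarrow> ('n, 'a) mpoly \<Rightarrow> 'n pp" where
  "cofactor tle F f = pp_lcm (HT tle ` F) - HT tle f"

definition combination ::
    "(('n::finite) pp \<Rightarrow> 'n pp \<Rightarrow> bool) \<Rightarrow> ('n, 'a::comm_ring_1) mpoly set \<Rightarrow>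
     (('n, 'a) mpoly \<Rightarrow> 'a) \<Rightarrow> ('n, 'a) mpoly" where
  "combination tle F h = (\<Sum>f\<in>F. Poly_Mapping.single (cofactor tle F f) (h f) * f)"

text \<open>
  The fixed choices made for every \<open>F\<close>: \<open>rep F g\<close> is the vector of coefficients in the
  representation of \<open>g \<in> groebner (HC ` F)\<close>, and \<open>syz F\<close> is the generating set of the
  module of solutions.
\<close>

locale critical_pairs =
  reduction_ring red groebner + admissible_order tle tless
  for red :: "'a::comm_ring_1 set \<Rightarrow> 'a \<Rightarrow> 'a \<Rightarrow> bool"
    and groebner :: "'a set \<Rightarrow> 'a set"
    and tle tless :: "('n::finite) pp \<Rightarrow> 'n pp \<Rightarrow> bool" +
  fixes rep :: "('n, 'a) mpoly set \<Rightarrow> 'a \<Rightarrow> ('n, 'a) mpoly \<Rightarrow> 'a"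
    and syz :: "('n, 'a) mpoly set \<Rightarrow> (('n, 'a) mpoly \<Rightarrow>\<^sub>0 'a) set"
  assumes rep: "finite F \<Longrightarrow> F \<noteq> {} \<Longrightarrow> 0 \<notin> F \<Longrightarrow> g \<in> groebner (HC tle ` F) \<Longrightarrow>
        g = (\<Sum>f\<in>F. rep F g f * HC tle f)"
    and finite_syz: "finite F \<Longrightarrow> F \<noteq> {} \<Longrightarrow> 0 \<notin> F \<Longrightarrow> finite (syz F)"
    and syz: "finite F \<Longrightarrow> F \<noteq> {} \<Longrightarrow> 0 \<notin> F \<Longrightarrow>
        module.span tuple_scale (syz F) = solutions F (HC tle)"

definition G_polynomials ::
    "('a::comm_ring_1 set \<Rightarrow> 'a set) \<Rightarrow> (('n::finite) pp \<Rightarrow> 'n pp \<Rightarrow> bool) \<Rightarrow>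
     (('n, 'a) mpoly set \<Rightarrow> 'a \<Rightarrow> ('n, 'a) mpoly \<Rightarrow> 'a) \<Rightarrow>
     ('n, 'a) mpoly set \<Rightarrow> ('n, 'a) mpoly set" where
  "G_polynomials groebner tle rep B =
     {combination tle F (rep F g) | F g.
        finite F \<and> F \<noteq> {} \<and> F \<subseteq> B \<and> g \<in> groebner (HC tle ` F)}"

definition M_polynomials ::
    "(('n::finite) pp \<Rightarrow> 'n pp \<Rightarrow> bool) \<Rightarrow>
     (('n, 'a::comm_ring_1) mpoly set \<Rightarrow> (('n, 'a) mpoly \<Rightarrow>\<^sub>0 'a) set) \<Rightarrow>
     ('n, 'a) mpoly set \<Rightarrow> ('n, 'a) mpoly set" where
  "M_polynomials tle syz B =
     {combination tle F (Poly_Mapping.lookup b) | F b. finite F \<and> F \<noteq> {} \<and> F \<subseteq> B \<and> b \<in> syz F}"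

end

theory Submission
  imports Defs
begin

text \<open>
  A reduction to \<open>0\<close> of a polynomial writes it as a sum of monomial multiples
  \<open>c s f\<close> of members \<open>f\<close> of \<open>B\<close> whose formal head terms \<open>s HT(f)\<close> do not exceed its own head
  term (\<open>reduces_to_0_represented\<close>). The M-polynomials are used to bring every nonzero \<open>p\<close> in the
  ideal into such a form (\<open>ideal_represented_HT\<close>). Start with any representation and let \<open>t\<close> be
  its largest formal head term. If \<open>t\<close> is not the head term of \<open>p\<close>, the coefficients at \<open>t\<close>
  cancel, so they form a solution of the linear equation in the head coefficients of the members
  involved. The summands at \<open>t\<close> are therefore a multiple of an \<open>R\<close>-linear combination of
  M-polynomials, and these have representations below the common multiple of the head terms;
  replacing them lowers \<open>t\<close> (\<open>represented_lower\<close>). Terms are well-ordered, so this ends.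

  Comparing coefficients at \<open>HT(p)\<close> in such a form, \<open>HC(p)\<close> lies in the ideal generated by the
  head coefficients of those members of \<open>B\<close> whose head terms divide \<open>HT(p)\<close>. Hence it reduces
  using nonzero members \<open>g\<close> of the weak Groebner basis computed for these coefficients. Each \<open>g\<close>
  is the head coefficient of a G-polynomial, and the reduction of that polynomial to \<open>0\<close> must at
  some moment reduce \<open>g\<close> (\<open>groebner_element_reducible\<close>). The transitivity axiom of reduction
  rings then makes \<open>HC(p)\<close> itself reducible using head coefficients of \<open>B\<close>
  (\<open>head_coefficient_reducible\<close>), that is, the head monomial of \<open>p\<close> is reducible using \<open>B\<close>.
  Reducing it stays in the ideal and decreases \<open>(HT, HC)\<close> in the lexicographic product of the
  term order and the well-founded reduction of \<open>R\<close>, so only \<open>0\<close> remains in the end.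
\<close>

section \<open>Multiplication by monomials\<close>

lemma pp_dvd_add_diff: "pp_dvd s t \<Longrightarrow> t - s + s = t"
  unfolding pp_dvd_def by auto

lemma pp_dvd_diff_trans:
  assumes "pp_dvd s u" "pp_dvd u t"
  shows "t - s = (t - u) + (u - s)" "pp_dvd s t"
  using assms unfolding pp_dvd_def by (auto simp: add.assoc[symmetric])

lemma lookup_single_times_add:
  fixes f :: "('n, 'a::comm_ring_1) mpoly"
  shows "Poly_Mapping.lookup (Poly_Mapping.single s c * f) (s + v) = c * Poly_Mapping.lookup f v"
proof -
  have "Poly_Mapping.lookup (Poly_Mapping.single s c * f) (s + v)
      = Sum_any (\<lambda>l. (c when s = l) *
          Sum_any (\<lambda>q. Poly_Mapping.lookup f q when s + v = l + q))"
    by (simp add: lookup_mult lookup_single)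
  also have "\<dots> = Sum_any (\<lambda>l. (c *
          Sum_any (\<lambda>q. Poly_Mapping.lookup f q when s + v = l + q)) when s = l)"
    by (simp add: when_mult)
  also have "\<dots> = c * Poly_Mapping.lookup f v"
    by simp
  finally show ?thesis .
qed

lemma keys_single_times_subset:
  fixes f :: "('n, 'a::comm_ring_1) mpoly"
  shows "Poly_Mapping.keys (Poly_Mapping.single s c * f) \<subseteq> (+) s ` Poly_Mapping.keys f"
  using keys_mult[of "Poly_Mapping.single s c" f] by (auto split: if_splits)

lemma poly_eq_sum_singles:
  fixes p :: "('n, 'a::comm_ring_1) mpoly"
  shows "p = (\<Sum>s\<in>Poly_Mapping.keys p. Poly_Mapping.single s (Poly_Mapping.lookup p s))"
  by (rule poly_mapping_eqI) (simp add: lookup_sum lookup_single when_def in_keys_iff)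

text \<open>
  Lifting the head terms of all members of \<open>F\<close> to one common multiple \<open>t\<close> and combining with
  coefficients from \<open>R\<close>. Both the correction in a polynomial reduction step and the critical
  pairs have this shape.
\<close>

definition aligned_sum ::
    "('n pp \<Rightarrow> 'n pp \<Rightarrow> bool) \<Rightarrow> 'n pp \<Rightarrow> ('n, 'a::comm_ring_1) mpoly set \<Rightarrow>
     (('n, 'a) mpoly \<Rightarrow> 'a) \<Rightarrow> ('n, 'a) mpoly" where
  "aligned_sum tle t F k = (\<Sum>f\<in>F. Poly_Mapping.single (t - HT tle f) (k f) * f)"

lemma combination_eq_aligned_sum:
  "combination tle F h = aligned_sum tle (pp_lcm (HT tle ` F)) F h"
  by (simp add: combination_def aligned_sum_def cofactor_def)

lemma aligned_sum_add:
  "aligned_sum tle t F (\<lambda>f. h f + k f) = aligned_sum tle t F h + aligned_sum tle t F k"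
  by (simp add: aligned_sum_def single_add distrib_right sum.distrib)

lemma single_times_aligned_sum:
  assumes "\<And>f. f \<in> F \<Longrightarrow> pp_dvd (HT tle f) u" "pp_dvd u t"
  shows "Poly_Mapping.single (t - u) r * aligned_sum tle u F k
       = aligned_sum tle t F (\<lambda>f. r * k f)"
  unfolding aligned_sum_def sum_distrib_left
  by (intro sum.cong refl)
     (simp add: mult.assoc[symmetric] mult_single pp_dvd_diff_trans(1)[OF assms(1) assms(2)])

section \<open>Representations with bounded head terms\<close>

text \<open>
  The set \<open>U\<close> restricts the formal head terms \<open>s HT(f)\<close> of the summands. The coefficient
  \<open>c HC(f)\<close> of such a term may vanish, as \<open>R\<close> may have zero divisors. Bounding formal head terms
  by \<open>t\<close> is thus stronger than bounding the terms that occur, and is stable under sums.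
\<close>

inductive_set represented ::
    "('n pp \<Rightarrow> 'n pp \<Rightarrow> bool) \<Rightarrow> ('n, 'a::comm_ring_1) mpoly set \<Rightarrow> 'n pp set \<Rightarrow>
     ('n, 'a) mpoly set"
  for tle B U where
  zero: "0 \<in> represented tle B U"
| add: "f \<in> B \<Longrightarrow> s + HT tle f \<in> U \<Longrightarrow> q \<in> represented tle B U \<Longrightarrow>
    Poly_Mapping.single s c * f + q \<in> represented tle B U"

lemma represented_single:
  "f \<in> B \<Longrightarrow> s + HT tle f \<in> U \<Longrightarrow> Poly_Mapping.single s c * f \<in> represented tle B U"
  using represented.add[OF _ _ represented.zero] by fastforce

lemma represented_plus:
  "p \<in> represented tle B U \<Longrightarrow> q \<in> represented tle B U \<Longrightarrow> p + q \<in> represented tle B U"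
  by (induction rule: represented.induct) (auto simp: add.assoc intro: represented.add)

lemma represented_sum:
  "(\<And>i. i \<in> I \<Longrightarrow> g i \<in> represented tle B U) \<Longrightarrow> sum g I \<in> represented tle B U"
  by (induction I rule: infinite_finite_induct)
     (auto intro: represented.zero represented_plus)

lemma represented_mono:
  assumes "p \<in> represented tle B U" "U \<subseteq> V"
  shows "p \<in> represented tle B V"
  using assms by induction (auto intro: represented.intros)

lemma represented_single_times:
  assumes "p \<in> represented tle B U" "\<And>u. u \<in> U \<Longrightarrow> s + u \<in> V"
  shows "Poly_Mapping.single s c * p \<in> represented tle B V"
  using assms
proof induction
  case (add f t q d)
  have "Poly_Mapping.single s c * (Poly_Mapping.single t d * f + q)
      = Poly_Mapping.single (s + t) (c * d) * f + Poly_Mapping.single s c * q"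
    by (simp add: distrib_left mult.assoc[symmetric] mult_single)
  moreover have "s + t + HT tle f \<in> V"
    using add by (simp add: add.assoc)
  ultimately show ?case
    using add by (simp add: represented.add)
qed (simp add: represented.zero)

lemma represented_times:
  "p \<in> represented tle B UNIV \<Longrightarrow> h * p \<in> represented tle B UNIV"
  by (subst poly_eq_sum_singles[of h])
     (auto simp: sum_distrib_right intro!: represented_sum represented_single_times)

lemma ideal_gen_eq_represented: "ideal_gen B = represented tle B UNIV"
proof
  show "ideal_gen B \<subseteq> represented tle B UNIV"
  proof (rule module.span_minimal[OF module_times])
    show "B \<subseteq> represented tle B UNIV"
    proof
      fix f assume "f \<in> B"
      then show "f \<in> represented tle B UNIV"
        using represented_single[of f B 0 tle UNIV 1] by simp
    qed
    show "is_ideal (represented tle B UNIV)"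
      by (intro module.subspaceI[OF module_times])
         (auto intro: represented.zero represented_plus represented_times)
  qed
  show "represented tle B UNIV \<subseteq> ideal_gen B"
  proof
    fix p assume "p \<in> represented tle B UNIV"
    then show "p \<in> ideal_gen B"
      by induction (simp_all add: module.span_zero[OF module_times]
          module.span_add[OF module_times] module.span_scale[OF module_times]
          module.span_base[OF module_times])
  qed
qed

lemma aligned_sum_represented:
  assumes "F \<subseteq> B" "\<And>f. f \<in> F \<Longrightarrow> pp_dvd (HT tle f) t" "t \<in> U"
  shows "aligned_sum tle t F k \<in> represented tle B U"
  unfolding aligned_sum_def
  using assms by (intro represented_sum represented_single) (auto simp: pp_dvd_add_diff)

text \<open>
  A polynomial reduction step subtracts an aligned sum whose leading coefficients account
  exactly for the reduction of one coefficient.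
\<close>

lemma poly_red_iff:
  "poly_red red tle P p q \<longleftrightarrow>
     0 \<notin> P \<and>
     (\<exists>t\<in>Poly_Mapping.keys p. (\<forall>f\<in>P. pp_dvd (HT tle f) t) \<and>
        (\<exists>d k. red (HC tle ` P) (Poly_Mapping.lookup p t) d \<and>
               Poly_Mapping.lookup p t = (\<Sum>f\<in>P. k f * HC tle f) + d \<and>
               q = p - aligned_sum tle t P k))"
  by (simp add: poly_red_def aligned_sum_def)

context admissible_order
begin

lemma tless_add: "tless s t \<Longrightarrow> tless (s + u) (t + u)"
  using tle_add[of s t u] by (simp add: less_le)

abbreviation keys_le :: "('n, 'a::comm_ring_1) mpoly \<Rightarrow> 'n pp \<Rightarrow> bool" where
  "keys_le p t \<equiv> \<forall>u\<in>Poly_Mapping.keys p. tle u t"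

lemma keys_le_diff: "keys_le p t \<Longrightarrow> keys_le q t \<Longrightarrow> keys_le (p - q) t"
  using keys_diff[of p q] by auto

lemma keys_le_sum: "(\<And>i. i \<in> I \<Longrightarrow> keys_le (g i) t) \<Longrightarrow> keys_le (sum g I) t"
  by (auto dest!: subsetD[OF keys_sum])

lemma HT_in_keys: "p \<noteq> 0 \<Longrightarrow> HT tle p \<in> Poly_Mapping.keys p"
  unfolding HT_def by (rule Max_in) auto

lemma keys_le_HT: "keys_le p (HT tle p)"
  unfolding HT_def by (auto intro: Max_ge)

lemma HT_eqI: "keys_le p t \<Longrightarrow> Poly_Mapping.lookup p t \<noteq> 0 \<Longrightarrow> HT tle p = t"
  unfolding HT_def by (rule Max_eqI) (auto simp: in_keys_iff)

lemma HT_tless: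
  assumes "keys_le p t" "Poly_Mapping.lookup p t = 0" "p \<noteq> 0"
  shows "tless (HT tle p) t"
  using assms HT_in_keys[of p] by (auto simp: less_le in_keys_iff)

lemma keys_le_single_times:
  assumes "tle (s + HT tle f) t"
  shows "keys_le (Poly_Mapping.single s c * f) t"
proof
  fix u assume "u \<in> Poly_Mapping.keys (Poly_Mapping.single s c * f)"
  then obtain v where v: "v \<in> Poly_Mapping.keys f" "u = s + v"
    using keys_single_times_subset[of s c f] by blast
  then have "tle u (s + HT tle f)"
    using tle_add[of v "HT tle f" s] keys_le_HT[of f] by (simp add: add.commute)
  then show "tle u t"
    using assms order_trans by blast
qed

lemma keys_le_aligned_sum:
  assumes "\<And>f. f \<in> F \<Longrightarrow> pp_dvd (HT tle f) t" "tle t u"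
  shows "keys_le (aligned_sum tle t F k) u"
  unfolding aligned_sum_def
  using assms by (intro keys_le_sum keys_le_single_times) (simp add: pp_dvd_add_diff)

lemma lookup_aligned_sum:
  assumes "\<And>f. f \<in> F \<Longrightarrow> pp_dvd (HT tle f) t"
  shows "Poly_Mapping.lookup (aligned_sum tle t F k) t = (\<Sum>f\<in>F. k f * HC tle f)"
proof -
  have "Poly_Mapping.lookup (Poly_Mapping.single (t - HT tle f) (k f) * f) t = k f * HC tle f"
    if "f \<in> F" for f
    using lookup_single_times_add[of "t - HT tle f" "k f" f "HT tle f"] assms[OF that]
    by (simp add: pp_dvd_add_diff HC_def)
  then show ?thesis
    by (simp add: aligned_sum_def lookup_sum)
qed

lemma keys_le_represented:
  assumes "p \<in> represented tle B U" "\<And>u. u \<in> U \<Longrightarrow> tle u t"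
  shows "keys_le p t"
  using assms
proof induction
  case (add f s q c)
  then show ?case
    using keys_add[of "Poly_Mapping.single s c * f" q] keys_le_single_times[of s f t c] by blast
qed simp

lemma lookup_represented_less:
  assumes "p \<in> represented tle B {u. tless u t}"
  shows "Poly_Mapping.lookup p t = 0"
  using assms
proof induction
  case (add f s q c)
  then have "\<not> tle t (s + HT tle f)"
    by (simp add: not_le)
  then have "t \<notin> Poly_Mapping.keys (Poly_Mapping.single s c * f)"
    using keys_le_single_times[of s f "s + HT tle f" c] by auto
  then show ?case
    using add by (simp add: lookup_add in_keys_iff)
qed simp

lemma represented_bounded:
  assumes "p \<in> represented tle B U"
  shows "p = 0 \<or> (\<exists>t\<in>U. p \<in> represented tle B {u. tle u t})"
  using assms
proof induction
  case (add f s q c)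
  let ?v = "s + HT tle f"
  show ?case
  proof (cases "q = 0")
    case True
    then show ?thesis
      using add represented_single[of f B s tle "{u. tle u ?v}" c] by auto
  next
    case False
    then obtain t where t: "t \<in> U" "q \<in> represented tle B {u. tle u t}"
      using add by blast
    let ?m = "if tle ?v t then t else ?v"
    have m: "tle ?v ?m" "tle t ?m" "?m \<in> U"
      using t add linear[of ?v t] by auto
    have "q \<in> represented tle B {u. tle u ?m}"
      using t(2) m(2) by (rule_tac represented_mono) (auto intro: order_trans)
    then have "Poly_Mapping.single s c * f + q \<in> represented tle B {u. tle u ?m}"
      using add m(1) by (intro represented.add) auto
    then show ?thesis
      using m(3) by blast
  qed
qed simp

text \<open>
  Collecting the monomial multiples whose formal head term is exactly \<open>t\<close>; each member of \<open>B\<close>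
  contributes at most one of them.
\<close>

lemma represented_top_decomposition:
  assumes "finite B" "p \<in> represented tle B {u. tle u t}"
  obtains k r where "p = aligned_sum tle t {f\<in>B. pp_dvd (HT tle f) t} k + r"
    "r \<in> represented tle B {u. tless u t}"
proof -
  let ?D = "{f\<in>B. pp_dvd (HT tle f) t}"
  have "\<exists>k. \<exists>r\<in>represented tle B {u. tless u t}. p = aligned_sum tle t ?D k + r"
    using assms(2)
  proof induction
    case zero
    show ?case
      by (intro exI[of _ "\<lambda>_. 0"] bexI[OF _ represented.zero]) (simp add: aligned_sum_def)
  next
    case (add f s q c)
    then obtain k r where kr: "r \<in> represented tle B {u. tless u t}"
      "q = aligned_sum tle t ?D k + r"
      by blast
    show ?case
    proof (cases "s + HT tle f = t")
      case True
      then have f: "f \<in> ?D" and s: "t - HT tle f = s"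
        using add by (auto simp: pp_dvd_def)
      have "aligned_sum tle t ?D (\<lambda>g. if g = f then c else 0)
          = (\<Sum>g\<in>?D. if g = f then Poly_Mapping.single s c * f else 0)"
        unfolding aligned_sum_def using s by (intro sum.cong) auto
      also have "\<dots> = Poly_Mapping.single s c * f"
        using f assms(1) by simp
      finally have "Poly_Mapping.single s c * f + q
          = aligned_sum tle t ?D (\<lambda>g. (if g = f then c else 0) + k g) + r"
        by (simp only: aligned_sum_add kr(2) add.assoc)
      then show ?thesis
        using kr(1) by blast
    next
      case False
      then have "Poly_Mapping.single s c * f + r \<in> represented tle B {u. tless u t}"
        using add kr(1) by (intro represented.add) (auto simp: less_le)
      moreover have "Poly_Mapping.single s c * f + q
          = aligned_sum tle t ?D k + (Poly_Mapping.single s c * f + r)"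
        by (simp add: kr(2) algebra_simps)
      ultimately show ?thesis
        by blast
    qed
  qed
  then show ?thesis
    using that by blast
qed

section \<open>Consequences of reducing to zero\<close>

text \<open>
  Each step works at a term that is present and changes nothing above it, so the formal head
  terms of all the corrections, which add up to the polynomial, respect the initial bound.
\<close>

lemma reduces_to_0_represented:
  assumes "reduces_to (poly_red red tle) B p 0" "keys_le p t"
  shows "p \<in> represented tle B {u. tle u t}"
  using assms
proof (induction rule: converse_rtranclp_induct)
  case base
  show ?case
    by (rule represented.zero)
next
  case (step p q)
  from step(1) obtain P v k where P: "P \<subseteq> B" "\<forall>f\<in>P. pp_dvd (HT tle f) v"
    "v \<in> Poly_Mapping.keys p" "q = p - aligned_sum tle v P k"
    unfolding step_using_def poly_red_iff by blast
  then have v: "tle v t"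
    using step(4) by blast
  have "keys_le q t"
    unfolding P(4) using P v step(4) by (intro keys_le_diff keys_le_aligned_sum) auto
  then have "q \<in> represented tle B {u. tle u t}"
    by (rule step(3))
  moreover have "aligned_sum tle v P k \<in> represented tle B {u. tle u t}"
    using P v by (intro aligned_sum_represented) auto
  moreover have "p = q + aligned_sum tle v P k"
    by (simp add: P(4))
  ultimately show ?case
    using represented_plus by metis
qed

text \<open>
  Until some step acts on the largest term \<open>t\<close>, its coefficient stays the same; since it has to
  disappear, some step does act on it.
\<close>

lemma reduces_to_0_head_reducible:
  assumes "reduces_to (poly_red red tle) B p 0" "keys_le p t" "Poly_Mapping.lookup p t \<noteq> 0"
  shows "reducible_using red (HC tle ` {f\<in>B. pp_dvd (HT tle f) t}) (Poly_Mapping.lookup p t)"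
  using assms
proof (induction rule: converse_rtranclp_induct)
  case base
  then show ?case by simp
next
  case (step p q)
  from step(1) obtain P v k d where P: "finite P" "P \<noteq> {}" "P \<subseteq> B" "\<forall>f\<in>P. pp_dvd (HT tle f) v"
    "v \<in> Poly_Mapping.keys p" "q = p - aligned_sum tle v P k"
    "red (HC tle ` P) (Poly_Mapping.lookup p v) d"
    unfolding step_using_def poly_red_iff by blast
  show ?case
  proof (cases "v = t")
    case True
    then have "HC tle ` P \<subseteq> HC tle ` {f\<in>B. pp_dvd (HT tle f) t}"
      using P by auto
    then show ?thesis
      unfolding reducible_using_def step_using_def using P True by blast
  next
    case False
    then have v: "tless v t"
      using P(5) step(4) by (auto simp: less_le)
    have "keys_le q t"
      unfolding P(6) using P(4) v step(4)
      by (intro keys_le_diff keys_le_aligned_sum) (auto simp: less_le)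
    moreover have "Poly_Mapping.lookup (aligned_sum tle v P k) t = 0"
      using v P(3,4) by (intro lookup_represented_less[where B = B] aligned_sum_represented) auto
    then have "Poly_Mapping.lookup q t = Poly_Mapping.lookup p t"
      by (simp add: P(6) lookup_minus)
    ultimately show ?thesis
      using step(3,5) by simp
  qed
qed

end

lemma reducible_using_mono:
  "reducible_using red S a \<Longrightarrow> S \<subseteq> T \<Longrightarrow> reducible_using red T a"
  unfolding reducible_using_def step_using_def by blast

lemma ideal_gen_image:
  assumes "finite P" "inj_on h P" "a \<in> ideal_gen (h ` P)"
  obtains k where "a = (\<Sum>f\<in>P. k f * h f)"
proof -
  obtain u where "a = (\<Sum>x\<in>h ` P. u x * x)"
    using assms(1,3) module.span_finite[OF module_times, of "h ` P"] by auto
  then have "a = (\<Sum>f\<in>P. u (h f) * h f)"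
    using assms(2) by (simp add: sum.reindex)
  then show ?thesis
    using that[of "\<lambda>f. u (h f)"] by simp
qed

section \<open>M-polynomials and G-polynomials\<close>

context critical_pairs
begin

lemma pp_dvd_HT_lcm:
  "finite F \<Longrightarrow> f \<in> F \<Longrightarrow> pp_dvd (HT tle f) (pp_lcm (HT tle ` F))"
  using pp_lcm_dvd_iff[of "HT tle ` F" "pp_lcm (HT tle ` F)"] by (auto simp: pp_dvd_iff)

text \<open>
  Over \<open>R\<close>, the M-polynomials of \<open>F\<close> span all its combinations that cancel at the common multiple
  of the head terms, and each of them reduces to \<open>0\<close> and is thus represented below that term.
\<close>

lemma syzygy_represented:
  fixes a :: "('n, 'a) mpoly \<Rightarrow>\<^sub>0 'a"
  assumes M: "\<forall>q \<in> M_polynomials tle syz B. reduces_to (poly_red red tle) B q 0"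
    and F: "finite F" "F \<noteq> {}" "F \<subseteq> B" "0 \<notin> F"
    and a: "a \<in> solutions F (HC tle)"
  shows "combination tle F (Poly_Mapping.lookup a)
           \<in> represented tle B {u. tless u (pp_lcm (HT tle ` F))}"
proof -
  let ?l = "pp_lcm (HT tle ` F)"
  let ?V = "represented tle B {u. tless u ?l}"
  let ?K = "{a. combination tle F (Poly_Mapping.lookup a) \<in> ?V}"
  note dvd = pp_dvd_HT_lcm[OF F(1)]
  have "module.span tuple_scale (syz F) \<subseteq> ?K"
  proof (rule module.span_minimal[OF module_tuple_scale])
    show "syz F \<subseteq> ?K"
    proof
      fix b assume b: "b \<in> syz F"
      let ?q = "combination tle F (Poly_Mapping.lookup b)"
      have "b \<in> solutions F (HC tle)"
        using b syz[OF F(1,2,4)] module.span_base[OF module_tuple_scale] by blast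
      then have l0: "Poly_Mapping.lookup ?q ?l = 0"
        unfolding combination_eq_aligned_sum
        by (subst lookup_aligned_sum[OF dvd]) (auto simp: solutions_def)
      have le: "keys_le ?q ?l"
        unfolding combination_eq_aligned_sum by (rule keys_le_aligned_sum[OF dvd]) auto
      have red0: "reduces_to (poly_red red tle) B ?q 0"
        using M b F unfolding M_polynomials_def by blast
      show "b \<in> ?K"
      proof (cases "?q = 0")
        case True
        then show ?thesis by (simp add: represented.zero)
      next
        case False
        have "tless (HT tle ?q) ?l"
          using le l0 False by (rule HT_tless)
        moreover have "?q \<in> represented tle B {u. tle u (HT tle ?q)}"
          using red0 keys_le_HT by (rule reduces_to_0_represented)
        ultimately show ?thesis
          by (auto elim!: represented_mono intro: le_less_trans)
      qed
    qed
    show "module.subspace tuple_scale ?K"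
    proof (rule module.subspaceI[OF module_tuple_scale])
      show "0 \<in> ?K"
        by (simp add: combination_eq_aligned_sum aligned_sum_def represented.zero)
    next
      fix x y assume xy: "x \<in> ?K" "y \<in> ?K"
      have "Poly_Mapping.lookup (x + y) = (\<lambda>f. Poly_Mapping.lookup x f + Poly_Mapping.lookup y f)"
        by (simp add: fun_eq_iff lookup_add)
      then show "x + y \<in> ?K"
        using xy by (simp add: combination_eq_aligned_sum aligned_sum_add represented_plus)
    next
      fix c x assume "x \<in> ?K"
      then have "Poly_Mapping.single (?l - ?l) c * combination tle F (Poly_Mapping.lookup x) \<in> ?V"
        by (auto intro: represented_single_times)
      moreover have "Poly_Mapping.lookup (tuple_scale c x) = (\<lambda>f. c * Poly_Mapping.lookup x f)"
        by (simp add: fun_eq_iff lookup_tuple_scale)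
      then have "Poly_Mapping.single (?l - ?l) c * combination tle F (Poly_Mapping.lookup x)
          = combination tle F (Poly_Mapping.lookup (tuple_scale c x))"
        unfolding combination_eq_aligned_sum
        by (subst single_times_aligned_sum[OF dvd]) (auto simp: pp_dvd_iff)
      ultimately show "tuple_scale c x \<in> ?K"
        by simp
    qed
  qed
  then show ?thesis
    using a syz[OF F(1,2,4)] by blast
qed

text \<open>
  If the head terms of the summands at the bound cancel, their coefficients form a solution of
  the linear equation in the head coefficients, and the bound can be lowered.
\<close>

lemma represented_lower:
  assumes M: "\<forall>q \<in> M_polynomials tle syz B. reduces_to (poly_red red tle) B q 0"
    and B: "finite B" "0 \<notin> B"
    and p: "p \<in> represented tle B {u. tle u t}" "Poly_Mapping.lookup p t = 0"
  shows "p \<in> represented tle B {u. tless u t}"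
proof -
  define D where "D = {f\<in>B. pp_dvd (HT tle f) t}"
  obtain k r where kr: "p = aligned_sum tle t D k + r" "r \<in> represented tle B {u. tless u t}"
    using represented_top_decomposition[OF B(1) p(1)] unfolding D_def by blast
  have D: "finite D" "D \<subseteq> B" "0 \<notin> D" and dvd: "\<And>f. f \<in> D \<Longrightarrow> pp_dvd (HT tle f) t"
    using B by (auto simp: D_def)
  show ?thesis
  proof (cases "D = {}")
    case True
    then show ?thesis
      using kr by (simp add: aligned_sum_def)
  next
    case False
    let ?l = "pp_lcm (HT tle ` D)"
    have lt: "pp_dvd ?l t"
      using pp_lcm_dvd_iff[of "HT tle ` D" t] D(1) False dvd by simp
    define a where "a = Abs_poly_mapping (\<lambda>f. if f \<in> D then k f else 0)"
    have "finite {f. (if f \<in> D then k f else 0) \<noteq> 0}"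
      by (rule finite_subset[OF _ D(1)]) auto
    then have a: "Poly_Mapping.lookup a f = (if f \<in> D then k f else 0)" for f
      by (simp add: a_def lookup_Abs_poly_mapping)
    have "(\<Sum>f\<in>D. k f * HC tle f) = 0"
      using p(2) lookup_aligned_sum[OF dvd, of D k] lookup_represented_less[OF kr(2)]
      unfolding kr(1) lookup_add by simp
    then have "a \<in> solutions D (HC tle)"
      unfolding solutions_def by (auto simp: a in_keys_iff split: if_splits)
    then have "combination tle D (Poly_Mapping.lookup a) \<in> represented tle B {u. tless u ?l}"
      using M D False by (intro syzygy_represented)
    then have "Poly_Mapping.single (t - ?l) 1 * combination tle D (Poly_Mapping.lookup a)
        \<in> represented tle B {u. tless u t}"
    proof (rule represented_single_times)
      fix u assume "u \<in> {u. tless u ?l}"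
      then have "tless (u + (t - ?l)) (?l + (t - ?l))"
        by (intro tless_add) simp
      then show "t - ?l + u \<in> {u. tless u t}"
        using pp_dvd_add_diff[OF lt] by (simp add: add.commute)
    qed
    moreover have "Poly_Mapping.single (t - ?l) 1 * combination tle D (Poly_Mapping.lookup a)
        = aligned_sum tle t D k"
    proof -
      have "Poly_Mapping.single (t - ?l) 1 * combination tle D (Poly_Mapping.lookup a)
          = aligned_sum tle t D (\<lambda>f. 1 * Poly_Mapping.lookup a f)"
        unfolding combination_eq_aligned_sum
        by (rule single_times_aligned_sum[OF pp_dvd_HT_lcm[OF D(1)] lt])
      also have "\<dots> = aligned_sum tle t D k"
        unfolding aligned_sum_def by (intro sum.cong) (auto simp: a)
      finally show ?thesis .
    qed
    ultimately show ?thesis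
      unfolding kr(1) using kr(2) by (simp add: represented_plus)
  qed
qed

text \<open>Lowering the bound stops only when it is the head term, since terms are well-ordered.\<close>

lemma ideal_represented_HT:
  assumes M: "\<forall>q \<in> M_polynomials tle syz B. reduces_to (poly_red red tle) B q 0"
    and B: "finite B" "0 \<notin> B"
    and p: "p \<in> ideal_gen B" "p \<noteq> 0"
  shows "p \<in> represented tle B {u. tle u (HT tle p)}"
proof -
  have "p \<in> represented tle B {u. tle u t} \<Longrightarrow> p \<in> represented tle B {u. tle u (HT tle p)}" for t
  proof (induction t rule: less_induct)
    case (less t)
    have le: "keys_le p t"
      using less.prems by (rule keys_le_represented) simp
    show ?case
    proof (cases "Poly_Mapping.lookup p t = 0")
      case True
      then show ?thesis
        using represented_lower[OF M B less.prems] represented_bounded p(2) less.IH by blast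
    next
      case False
      then show ?thesis
        using HT_eqI[OF le] less.prems by simp
    qed
  qed
  then show ?thesis
    using p represented_bounded unfolding ideal_gen_eq_represented[of B tle] by blast
qed

text \<open>
  A nonzero member \<open>g\<close> of the basis of the head coefficients of \<open>F\<close> is the head coefficient of
  its G-polynomial, whose reduction to \<open>0\<close> has to attack \<open>g\<close>.
\<close>

lemma groebner_element_reducible:
  assumes G: "\<forall>q \<in> G_polynomials groebner tle rep B. reduces_to (poly_red red tle) B q 0"
    and F: "finite F" "F \<noteq> {}" "F \<subseteq> B" "0 \<notin> F"
    and t: "\<And>f. f \<in> F \<Longrightarrow> pp_dvd (HT tle f) t"
    and g: "g \<in> groebner (HC tle ` F)" "g \<noteq> 0"
  shows "reducible_using red (HC tle ` {f\<in>B. pp_dvd (HT tle f) t}) g"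
proof -
  let ?l = "pp_lcm (HT tle ` F)"
  let ?q = "combination tle F (rep F g)"
  note dvd = pp_dvd_HT_lcm[OF F(1)]
  have red0: "reduces_to (poly_red red tle) B ?q 0"
    using G F(1-3) g(1) unfolding G_polynomials_def by blast
  have le: "keys_le ?q ?l"
    unfolding combination_eq_aligned_sum by (rule keys_le_aligned_sum[OF dvd]) auto
  have lk: "Poly_Mapping.lookup ?q ?l = g"
    unfolding combination_eq_aligned_sum
    using lookup_aligned_sum[OF dvd, of F "rep F g"] rep[OF F(1,2,4) g(1)] by simp
  have "pp_dvd ?l t"
    using pp_lcm_dvd_iff[of "HT tle ` F" t] F(1,2) t by simp
  then have "HC tle ` {f\<in>B. pp_dvd (HT tle f) ?l} \<subseteq> HC tle ` {f\<in>B. pp_dvd (HT tle f) t}"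
    using pp_dvd_diff_trans(2) by blast
  then show ?thesis
    using reduces_to_0_head_reducible[OF red0 le] g(2) by (auto simp: lk elim: reducible_using_mono)
qed

text \<open>
  The representation bounded by \<open>HT(p)\<close> puts \<open>HC(p)\<close> into the ideal of the head coefficients on
  the right, and transitivity of reducibility replaces the members of its weak Groebner basis by
  these coefficients.
\<close>

lemma head_coefficient_reducible:
  assumes G: "\<forall>q \<in> G_polynomials groebner tle rep B. reduces_to (poly_red red tle) B q 0"
    and M: "\<forall>q \<in> M_polynomials tle syz B. reduces_to (poly_red red tle) B q 0"
    and B: "finite B" "0 \<notin> B"
    and p: "p \<in> ideal_gen B" "p \<noteq> 0"
  shows "reducible_using red (HC tle ` {f\<in>B. pp_dvd (HT tle f) (HT tle p)}) (HC tle p)"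
proof -
  define D where "D = {f\<in>B. pp_dvd (HT tle f) (HT tle p)}"
  have D: "finite D" "D \<subseteq> B" "0 \<notin> D" and dvd: "\<And>f. f \<in> D \<Longrightarrow> pp_dvd (HT tle f) (HT tle p)"
    using B by (auto simp: D_def)
  obtain k r where kr: "p = aligned_sum tle (HT tle p) D k + r"
    "r \<in> represented tle B {u. tless u (HT tle p)}"
    using represented_top_decomposition[OF B(1) ideal_represented_HT[OF M B p]]
    unfolding D_def by blast
  have "HC tle p = (\<Sum>f\<in>D. k f * HC tle f)"
  proof -
    have "HC tle p = Poly_Mapping.lookup (aligned_sum tle (HT tle p) D k + r) (HT tle p)"
      unfolding HC_def using kr(1) by simp
    then show ?thesis
      using lookup_aligned_sum[OF dvd, of D k] lookup_represented_less[OF kr(2)]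
      by (simp add: lookup_add)
  qed
  then have inI: "HC tle p \<in> ideal_gen (HC tle ` D)"
    by (simp add: module.span_sum[OF module_times] module.span_scale[OF module_times]
        module.span_base[OF module_times])
  have nz: "HC tle p \<noteq> 0"
    using HT_in_keys[OF p(2)] by (simp add: HC_def in_keys_iff)
  then have "D \<noteq> {}"
    using \<open>HC tle p = _\<close> by auto
  have "reduces_to red (groebner (HC tle ` D) - {0}) (HC tle p) 0"
    using groebner_minus_zero[of "HC tle ` D"] D(1) inI
    unfolding weak_groebner_basis_def is_normal_form_of_def by blast
  then obtain c where "step_using red (groebner (HC tle ` D) - {0}) (HC tle p) c"
    using nz by (auto elim: converse_rtranclpE)
  then obtain S where S: "finite S" "S \<noteq> {}" "S \<subseteq> groebner (HC tle ` D) - {0}"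
    "red S (HC tle p) c"
    unfolding step_using_def by blast
  have "reducible_using red S (HC tle p)"
    using S unfolding reducible_using_def step_using_def by blast
  moreover have "reducible_using red (HC tle ` D) g" if "g \<in> S" for g
    using groebner_element_reducible[OF G D(1) \<open>D \<noteq> {}\<close> D(2,3) dvd] that S(3)
    unfolding D_def by blast
  ultimately have "reducible_using red (HC tle ` D) (HC tle p)"
    using red_trans[of S "HC tle ` D" "HC tle p"] S(1,2) D(1) \<open>D \<noteq> {}\<close> by simp
  then show ?thesis
    by (simp add: D_def)
qed

section \<open>Reduction of the ideal to zero\<close>

text \<open>
  A ring step \<open>HC(p) \<rightarrow> d\<close> lifts to a polynomial step at \<open>HT(p)\<close> that leaves \<open>d\<close> as the new
  coefficient there: the head term drops if \<open>d = 0\<close>, and otherwise \<open>d\<close> is the new head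
  coefficient.
\<close>

lemma ideal_head_step:
  assumes G: "\<forall>q \<in> G_polynomials groebner tle rep B. reduces_to (poly_red red tle) B q 0"
    and M: "\<forall>q \<in> M_polynomials tle syz B. reduces_to (poly_red red tle) B q 0"
    and B: "finite B" "0 \<notin> B"
    and p: "p \<in> ideal_gen B" "p \<noteq> 0"
  obtains q where "step_using (poly_red red tle) B p q" "q \<in> ideal_gen B"
    "q = 0 \<or> tless (HT tle q) (HT tle p) \<or>
      HT tle q = HT tle p \<and> step_using red UNIV (HC tle p) (HC tle q)"
proof -
  let ?t = "HT tle p"
  let ?D = "{f\<in>B. pp_dvd (HT tle f) ?t}"
  obtain S d where S: "finite S" "S \<noteq> {}" "S \<subseteq> HC tle ` ?D" "red S (HC tle p) d"
    using head_coefficient_reducible[OF G M B p]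
    unfolding reducible_using_def step_using_def by blast
  \<comment> \<open>One polynomial for each coefficient in \<open>S\<close>: coefficients in the representation of
    \<open>HC tle p - d\<close> can then be indexed by polynomials.\<close>
  then obtain P where P: "P \<subseteq> ?D" "inj_on (HC tle) P" "S = HC tle ` P"
    unfolding subset_image_inj by blast
  have fin: "finite P" "P \<noteq> {}"
    using P(1) B(1) S(2) P(3) by (auto intro: finite_subset)
  have dvd: "\<And>f. f \<in> P \<Longrightarrow> pp_dvd (HT tle f) ?t"
    using P(1) by blast
  obtain k where k: "HC tle p - d = (\<Sum>f\<in>P. k f * HC tle f)"
    using ideal_gen_image[OF fin(1) P(2)] red_diff[OF S(1,2,4)] P(3) by metis
  define q where "q = p - aligned_sum tle ?t P k"
  have "poly_red red tle P p q"
    unfolding poly_red_iff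
  proof (intro conjI bexI[OF _ HT_in_keys[OF p(2)]] exI)
    show "0 \<notin> P"
      using P(1) B(2) by blast
    show "red (HC tle ` P) (Poly_Mapping.lookup p ?t) d"
      using S(4) P(3) by (simp add: HC_def)
    show "Poly_Mapping.lookup p ?t = (\<Sum>f\<in>P. k f * HC tle f) + d"
      using k by (simp add: HC_def[of tle p] algebra_simps)
  qed (use dvd q_def in auto)
  then have "step_using (poly_red red tle) B p q"
    unfolding step_using_def using fin P(1) by blast
  moreover have "aligned_sum tle ?t P k \<in> ideal_gen B"
    unfolding ideal_gen_eq_represented[of B tle]
    using P(1) by (intro aligned_sum_represented) auto
  then have "q \<in> ideal_gen B"
    unfolding q_def using p(1) by (intro module.span_diff[OF module_times])
  moreover have "q = 0 \<or> tless (HT tle q) ?t \<or>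
      HT tle q = ?t \<and> step_using red UNIV (HC tle p) (HC tle q)"
  proof -
    have le: "keys_le q ?t"
      unfolding q_def by (intro keys_le_diff keys_le_HT keys_le_aligned_sum dvd) auto
    have lk: "Poly_Mapping.lookup q ?t = d"
      unfolding q_def using lookup_aligned_sum[OF dvd, of P k] k
      by (simp add: lookup_minus HC_def[of tle p] algebra_simps)
    show ?thesis
    proof (cases "d = 0")
      case True
      then show ?thesis
        using HT_tless[OF le] lk by blast
    next
      case False
      then have "HT tle q = ?t"
        using HT_eqI[OF le] lk by simp
      moreover from this have "HC tle q = d"
        using lk by (simp add: HC_def)
      ultimately show ?thesis
        using S unfolding step_using_def by auto
    qed
  qed
  ultimately show ?thesis
    using that by blast
qed

lemma ideal_reduces_to_0:
  assumes G: "\<forall>q \<in> G_polynomials groebner tle rep B. reduces_to (poly_red red tle) B q 0"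
    and M: "\<forall>q \<in> M_polynomials tle syz B. reduces_to (poly_red red tle) B q 0"
    and B: "finite B" "0 \<notin> B"
    and p: "p \<in> ideal_gen B"
  shows "reduces_to (poly_red red tle) B p 0"
proof -
  have wf_terms: "wf {(s, t). tless s t}"
    unfolding wf_def using less_induct by auto
  have wf_coeffs: "wf {(c, a). step_using red UNIV a c}"
    using red_wf by (simp add: wfp_def)
  define W where "W = inv_image ({(s, t). tless s t} <*lex*> {(c, a). step_using red UNIV a c})
    (\<lambda>p. (HT tle p, HC tle p))"
  have "wf W"
    unfolding W_def by (intro wf_inv_image wf_lex_prod wf_terms wf_coeffs)
  then show ?thesis
    using p
  proof (induction p rule: wf_induct_rule)
    case (less p)
    show ?case
    proof (cases "p = 0")
      case True
      then show ?thesis by simp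
    next
      case False
      then obtain q where q: "step_using (poly_red red tle) B p q" "q \<in> ideal_gen B"
        "q = 0 \<or> tless (HT tle q) (HT tle p) \<or>
          HT tle q = HT tle p \<and> step_using red UNIV (HC tle p) (HC tle q)"
        using ideal_head_step[OF G M B less.prems] by blast
      then have "q = 0 \<or> (q, p) \<in> W"
        by (auto simp: W_def)
      then have "reduces_to (poly_red red tle) B q 0"
        using less.IH q(2) by blast
      then show ?thesis
        using q(1) by (rule_tac converse_rtranclp_into_rtranclp)
    qed
  qed
qed

end

theorem theorem6p1:
  fixes red :: "'a::comm_ring_1 set \<Rightarrow> 'a \<Rightarrow> 'a \<Rightarrow> bool"
    and groebner :: "'a set \<Rightarrow> 'a set"
    and tle tless :: "('n::finite) pp \<Rightarrow> 'n pp \<Rightarrow> bool"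
    and rep :: "('n, 'a) mpoly set \<Rightarrow> 'a \<Rightarrow> ('n, 'a) mpoly \<Rightarrow> 'a"
    and syz :: "('n, 'a) mpoly set \<Rightarrow> (('n, 'a) mpoly \<Rightarrow>\<^sub>0 'a) set"
    and B :: "('n, 'a) mpoly set"
  assumes "critical_pairs red groebner tle tless rep syz"
    and "finite B" and "0 \<notin> B"
    and "\<forall>q \<in> G_polynomials groebner tle rep B. reduces_to (poly_red red tle) B q 0"
    and "\<forall>q \<in> M_polynomials tle syz B. reduces_to (poly_red red tle) B q 0"
  shows "(\<forall>p \<in> ideal_gen B. reduces_to (poly_red red tle) B p 0) \<and>
         weak_groebner_basis (poly_red red tle) B (ideal_gen B)"
proof -
  interpret critical_pairs red groebner tle tless rep syz
    by (rule assms(1))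
  have "reduces_to (poly_red red tle) B p 0" if "p \<in> ideal_gen B" for p
    using assms(2-5) that by (intro ideal_reduces_to_0)
  moreover have "\<not> reducible_using (poly_red red tle) B 0"
    by (simp add: reducible_using_def step_using_def poly_red_def)
  ultimately show ?thesis
    unfolding weak_groebner_basis_def is_normal_form_of_def by blast
qed

end
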